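(* Let $G_A$ and $G_B$ be graphs on $n$ and $m$ vertices with invertible adjacency matrices $A$ and $B$, respectively. Assume that $G_B$ is arbitrarily bridgeable over the first $k$ vertices. Then the least positive eigenvalue $\lambda_1^+(G_C)$ of the adjacency matrix $C$ of the bridged graph $G_C=\mathcal{B}_k(G_A,G_B)$ satisfies $$\lambda_1^+(G_C)\ \ge\ \frac{2}{\alpha\mu^*+\alpha+\beta+\sqrt{(\alpha\mu^*+\alpha+\beta)^2-4\alpha\beta}},$$ where $\mu^*=\max \sigma(B^{-1}H^THB^{-1})$ is the maximal eigenvalue of the positive semidefinite $m\times m$ matrix $B^{-1}H^THB^{-1}$, $\alpha=1/\lambda_1^+(G_A)$ and $\beta=1/\lambda_1^+(G_B)$.
   Context: Graphs are finite and undirected, possibly with multiple edges; the adjacency matrix $A$ of a graph $G_A$ is a symmetric matrix with nonnegative integer entries, and $G_A$ denotes the graph with adjacency matrix $A$. Integrality of the inverse matrices $A^{-1},B^{-1}$ is not required. $\sigma(\cdot)$ denotes the set of eigenvalues, and $\lambda_1^+(G)$ denotes the least positive eigenvalue of the adjacency matrix of $G$. Bridging: for $1\le k\le \min(n,m)$, $\mathcal{B}_k(G_A,G_B)$ is the graph $G_C$ on $n+m$ vertices with adjacency matrix $$C=\begin{pmatrix} A & H\\ H^T & B\end{pmatrix},\qquad H=\begin{pmatrix}0&0\\ I&0\end{pmatrix},$$ where $H$ is $n\times m$ and $I$ is the $k\times k$ identity matrix placed in the last $k$ rows and first $k$ columns of $H$; that is, the $i$-th of the last $k$ vertices of $G_A$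 is joined by an edge to the $i$-th vertex of $G_B$, $i=1,\dots,k$. A graph $G_B$ on $m$ vertices with invertible adjacency matrix $B$ is arbitrarily bridgeable over its first $k\le m/2$ vertices if the upper left $k\times k$ principal submatrix of $B^{-1}$ is the zero matrix. *)

theory Defs
  imports
    Complex_Main
    "Jordan_Normal_Form.Gauss_Jordan_Elimination"
    "Jordan_Normal_Form.Spectral_Radius"
begin

text \<open>
  A finite undirected multigraph on the vertices \<open>0, \<dots>, n - 1\<close> is identified with its
  adjacency matrix, a symmetric real matrix with nonnegative integer entries. The diagonal is
  not required to vanish, so loops are allowed.
\<close>

definition graph_mat :: "nat \<Rightarrow> real mat \<Rightarrow> bool" where
  "graph_mat n A \<longleftrightarrow>
     A \<in> carrier_mat n n \<and> transpose_mat A = A \<and> (\<forall>i<n. \<forall>j<n. A $$ (i, j) \<in> \<nat>)"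

text \<open>Meaningful for invertible matrices only; otherwise the value is unspecified.\<close>

definition inv_mat :: "real mat \<Rightarrow> real mat" where
  "inv_mat A = the (mat_inverse A)"

text \<open>
  Real eigenvalues suffice, the matrices being symmetric. An invertible \<^const>\<open>graph_mat\<close>
  of positive size has nonnegative trace and nonzero eigenvalues, hence a positive one, so that
  the minimum below is taken over a finite nonempty set.
\<close>

definition least_pos_eigenvalue :: "real mat \<Rightarrow> real" where
  "least_pos_eigenvalue A = Min {x \<in> spectrum A. 0 < x}"

text \<open>
  The \<open>n \<times> m\<close> matrix with the \<open>k \<times> k\<close> identity in its lower left corner; the block sizes
  are correct for \<open>k \<le> min n m\<close>.
\<close>

definition bridge_mat :: "nat \<Rightarrow> nat \<Rightarrow> nat \<Rightarrow> real mat" where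
  "bridge_mat n m k =
     four_block_mat (0\<^sub>m (n - k) k) (0\<^sub>m (n - k) (m - k))
                    (1\<^sub>m k)         (0\<^sub>m k (m - k))"

definition bridged_graph :: "nat \<Rightarrow> real mat \<Rightarrow> real mat \<Rightarrow> real mat" where
  "bridged_graph k A B =
     (let H = bridge_mat (dim_row A) (dim_row B) k
      in four_block_mat A H (transpose_mat H) B)"

definition arbitrarily_bridgeable :: "nat \<Rightarrow> real mat \<Rightarrow> bool" where
  "arbitrarily_bridgeable k B \<longleftrightarrow>
     invertible_mat B \<and> 2 * k \<le> dim_row B \<and> (\<forall>i<k. \<forall>j<k. inv_mat B $$ (i, j) = 0)"

end

theory Submission
  imports Defs
begin

text \<open>
  The reciprocal of the least positive eigenvalue of a nonsingular symmetric matrix that has a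
  positive eigenvalue is the maximum over the unit sphere of the quadratic form of the inverse. So
  an upper bound for the form of \<open>C\<^sup>-\<^sup>1\<close> is needed. Bridgeability says that \<open>H B\<^sup>-\<^sup>1 H\<^sup>T = 0\<close>,
  hence the Schur complement of \<open>B\<close> in \<open>C\<close> is \<open>A\<close> itself, and for a vector \<open>(u, v)\<close> the form
  of \<open>C\<^sup>-\<^sup>1\<close> is
  \<open>(u - H B\<^sup>-\<^sup>1 v)\<^sup>T A\<^sup>-\<^sup>1 (u - H B\<^sup>-\<^sup>1 v) + v\<^sup>T B\<^sup>-\<^sup>1 v \<le> \<alpha> |u - H B\<^sup>-\<^sup>1 v|\<^sup>2 + \<beta> |v|\<^sup>2\<close>.
  Since \<open>|H B\<^sup>-\<^sup>1 v|\<^sup>2 \<le> \<mu> |v|\<^sup>2\<close>, the right-hand side is bounded by a quadratic form in \<open>|u|\<close> and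
  \<open>|v|\<close> whose matrix has trace \<open>\<alpha> \<mu> + \<alpha> + \<beta>\<close> and determinant \<open>\<alpha> \<beta>\<close>. The larger eigenvalue of
  this matrix is the reciprocal of the claimed bound.

  The bounds on the quadratic forms come from the Rayleigh principle (\<open>rayleigh_eigenvalue\<close>),
  which is proved from coercivity of nonsingular positive semidefinite matrices. The matrix
  \<open>C\<^sup>-\<^sup>1\<close> is never written down: \<open>bridged_eigenvector_identities\<close> evaluates its form at an
  eigenvector \<open>(x, y)\<close> of \<open>C\<close>, and \<open>le_larger_root_of_form_le\<close> solves the resulting inequality
  for the reciprocal of the eigenvalue.
\<close>

section \<open>The Rayleigh principle for real symmetric matrices\<close>

lemma scalar_prod_self_eq_sum:
  fixes x :: "real vec"
  assumes "x \<in> carrier_vec n"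
  shows "x \<bullet> x = (\<Sum>i = 0..<n. (x $ i)\<^sup>2)"
  using assms by (simp add: scalar_prod_def power2_eq_square)

lemma scalar_prod_self_nonneg: "0 \<le> x \<bullet> (x :: real vec)"
  by (simp add: scalar_prod_def sum_nonneg)

lemma scalar_prod_self_eq_0_iff:
  fixes x :: "real vec"
  assumes "x \<in> carrier_vec n"
  shows "x \<bullet> x = 0 \<longleftrightarrow> x = 0\<^sub>v n"
proof
  assume "x \<bullet> x = 0"
  hence "\<forall>i\<in>{0..<n}. (x $ i)\<^sup>2 = 0"
    unfolding scalar_prod_self_eq_sum[OF assms] by (subst (asm) sum_nonneg_eq_0_iff) auto
  thus "x = 0\<^sub>v n" using assms by (intro eq_vecI) auto
qed (use assms in auto)

lemma symmetric_scalar_prod: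
  fixes M :: "real mat"
  assumes M: "M \<in> carrier_mat n n" "transpose_mat M = M"
    and x: "x \<in> carrier_vec n" and y: "y \<in> carrier_vec n"
  shows "x \<bullet> (M *\<^sub>v y) = y \<bullet> (M *\<^sub>v x)"
  using transpose_vec_mult_scalar[OF M(1) y x] M x y comm_scalar_prod[of "M *\<^sub>v x" n y] by simp

lemma quadratic_form_bounded:
  fixes M :: "real mat"
  assumes M: "M \<in> carrier_mat n n"
  obtains K where "0 < K" "\<And>x. x \<in> carrier_vec n \<Longrightarrow> x \<bullet> (M *\<^sub>v x) \<le> K * (x \<bullet> x)"
proof -
  define K where "K = (\<Sum>i = 0..<n. \<Sum>j = 0..<n. \<bar>M $$ (i,j)\<bar>)"
  have K0: "0 \<le> K" unfolding K_def by (intro sum_nonneg) auto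
  have bound: "x \<bullet> (M *\<^sub>v x) \<le> K * (x \<bullet> x)" if x: "x \<in> carrier_vec n" for x
  proof -
    have sq: "(x $ i)\<^sup>2 \<le> x \<bullet> x" if "i < n" for i
      unfolding scalar_prod_self_eq_sum[OF x] using that
      by (intro member_le_sum) auto
    have entry: "x $ i * (M $$ (i,j) * x $ j) \<le> \<bar>M $$ (i,j)\<bar> * (x \<bullet> x)"
      if "i < n" "j < n" for i j
    proof -
      have "0 \<le> (\<bar>x $ i\<bar> - \<bar>x $ j\<bar>)\<^sup>2" by simp
      hence "2 * (\<bar>x $ i\<bar> * \<bar>x $ j\<bar>) \<le> (x $ i)\<^sup>2 + (x $ j)\<^sup>2"
        by (simp add: power2_diff)
      hence "\<bar>x $ i\<bar> * \<bar>x $ j\<bar> \<le> x \<bullet> x"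
        using sq[OF that(1)] sq[OF that(2)] by linarith
      hence "\<bar>M $$ (i,j)\<bar> * (\<bar>x $ i\<bar> * \<bar>x $ j\<bar>) \<le> \<bar>M $$ (i,j)\<bar> * (x \<bullet> x)"
        by (intro mult_left_mono) auto
      moreover have "x $ i * (M $$ (i,j) * x $ j) \<le> \<bar>M $$ (i,j)\<bar> * (\<bar>x $ i\<bar> * \<bar>x $ j\<bar>)"
        using abs_ge_self[of "x $ i * (M $$ (i,j) * x $ j)"]
        by (simp add: abs_mult mult.left_commute)
      ultimately show ?thesis by linarith
    qed
    have "x \<bullet> (M *\<^sub>v x) = (\<Sum>i = 0..<n. \<Sum>j = 0..<n. x $ i * (M $$ (i,j) * x $ j))"
      using M x by (simp add: scalar_prod_def sum_distrib_left)
    also have "\<dots> \<le> (\<Sum>i = 0..<n. \<Sum>j = 0..<n. \<bar>M $$ (i,j)\<bar> * (x \<bullet> x))"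
      by (intro sum_mono entry) auto
    also have "\<dots> = K * (x \<bullet> x)" by (simp add: K_def sum_distrib_right)
    finally show ?thesis .
  qed
  have "x \<bullet> (M *\<^sub>v x) \<le> (K + 1) * (x \<bullet> x)" if "x \<in> carrier_vec n" for x
    using bound[OF that] scalar_prod_self_nonneg[of x] by (simp add: distrib_right)
  thus ?thesis using K0 that[of "K + 1"] by simp
qed

text \<open>
  For \<open>P y = x\<close>, nonnegativity of the form at \<open>x - s y\<close> reads
  \<open>x\<^sup>T P x \<ge> 2 s |x|\<^sup>2 - s\<^sup>2 x\<^sup>T P\<^sup>-\<^sup>1 x\<close>. The subtracted term is at most
  \<open>s\<^sup>2 K |x|\<^sup>2\<close> for some constant \<open>K\<close>, and \<open>s = 1 / K\<close> gives the bound. This takes the place of the compactness of the sphere.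
\<close>

lemma psd_nonsingular_imp_coercive:
  fixes P :: "real mat"
  assumes P: "P \<in> carrier_mat n n" "transpose_mat P = P" "det P \<noteq> 0"
    and psd: "\<And>x. x \<in> carrier_vec n \<Longrightarrow> 0 \<le> x \<bullet> (P *\<^sub>v x)"
  obtains c where "0 < c" "\<And>x. x \<in> carrier_vec n \<Longrightarrow> c * (x \<bullet> x) \<le> x \<bullet> (P *\<^sub>v x)"
proof -
  obtain Q where Q: "Q \<in> carrier_mat n n" "P * Q = 1\<^sub>m n"
    using det_non_zero_imp_unit[OF P(1,3), of "()"] unfolding Units_def ring_mat_def by auto
  obtain K where K: "0 < K" "\<And>x. x \<in> carrier_vec n \<Longrightarrow> x \<bullet> (Q *\<^sub>v x) \<le> K * (x \<bullet> x)"
    using quadratic_form_bounded[OF Q(1)] by blast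
  have "1 / K * (x \<bullet> x) \<le> x \<bullet> (P *\<^sub>v x)" if x: "x \<in> carrier_vec n" for x
  proof -
    define y where "y = Q *\<^sub>v x"
    define s where "s = 1 / K"
    have y: "y \<in> carrier_vec n" using Q x by (simp add: y_def)
    have Py: "P *\<^sub>v y = x"
      unfolding y_def using assoc_mult_mat_vec[OF P(1) Q(1) x] Q(2) x by simp
    have Px: "P *\<^sub>v x \<in> carrier_vec n" using P x by simp
    have ypx: "y \<bullet> (P *\<^sub>v x) = x \<bullet> x" using symmetric_scalar_prod[OF P(1,2) y x] Py by simp
    have "P *\<^sub>v (x - s \<cdot>\<^sub>v y) = P *\<^sub>v x - s \<cdot>\<^sub>v x"
      using P x y by (simp add: mult_minus_distrib_mat_vec[of _ n n] mult_mat_vec[of _ n n] Py)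
    hence "(x - s \<cdot>\<^sub>v y) \<bullet> (P *\<^sub>v (x - s \<cdot>\<^sub>v y))
        = x \<bullet> (P *\<^sub>v x) - s * (x \<bullet> x) - s * (x \<bullet> x) + s * s * (y \<bullet> x)"
      using x y Px ypx
      by (simp add: minus_scalar_prod_distrib[of _ n] scalar_prod_minus_distrib[of _ n]
          algebra_simps)
    moreover have "0 \<le> (x - s \<cdot>\<^sub>v y) \<bullet> (P *\<^sub>v (x - s \<cdot>\<^sub>v y))" using psd x y by simp
    moreover have "y \<bullet> x \<le> K * (x \<bullet> x)"
      using K(2)[OF x] comm_scalar_prod[OF y x] by (simp add: y_def)
    hence "s * s * (y \<bullet> x) \<le> s * s * (K * (x \<bullet> x))" by (intro mult_left_mono) auto
    moreover have "s * s * (K * (x \<bullet> x)) = s * (x \<bullet> x)" using K(1) by (simp add: s_def)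
    ultimately show ?thesis by (simp add: s_def[symmetric])
  qed
  thus ?thesis using K(1) that[of "1 / K"] by simp
qed

text \<open>
  The candidate \<open>t\<close> is the least number with \<open>x\<^sup>T M x \<le> t |x|\<^sup>2\<close> for all \<open>x\<close>. The matrix \<open>t I - M\<close> is
  then positive semidefinite, and it is singular because coercivity would allow a smaller \<open>t\<close>.
\<close>

lemma rayleigh_eigenvalue:
  fixes M :: "real mat"
  assumes M: "M \<in> carrier_mat n n" "transpose_mat M = M" and n: "0 < n"
  obtains t where "eigenvalue M t" "\<And>x. x \<in> carrier_vec n \<Longrightarrow> x \<bullet> (M *\<^sub>v x) \<le> t * (x \<bullet> x)"
proof -
  define T where "T = {t. \<forall>x\<in>carrier_vec n. x \<bullet> (M *\<^sub>v x) \<le> t * (x \<bullet> x)}"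
  obtain K where "\<And>x. x \<in> carrier_vec n \<Longrightarrow> x \<bullet> (M *\<^sub>v x) \<le> K * (x \<bullet> x)"
    using quadratic_form_bounded[OF M(1)] by blast
  hence "K \<in> T" by (simp add: T_def)
  hence ne: "T \<noteq> {}" by blast
  have e: "unit_vec n 0 \<bullet> unit_vec n 0 = (1::real)" using n by simp
  have lower: "unit_vec n 0 \<bullet> (M *\<^sub>v unit_vec n 0) \<le> t" if "t \<in> T" for t
    using that e unfolding T_def by (metis (mono_tags) mem_Collect_eq mult.right_neutral unit_vec_carrier)
  hence bdd: "bdd_below T" by (meson bdd_belowI)
  define t where "t = Inf T"
  have top: "x \<bullet> (M *\<^sub>v x) \<le> t * (x \<bullet> x)" if x: "x \<in> carrier_vec n" for x
  proof (cases "x \<bullet> x = 0")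
    case True
    thus ?thesis using scalar_prod_self_eq_0_iff[OF x] M x by (simp)
  next
    case False
    hence pos: "0 < x \<bullet> x" using scalar_prod_self_nonneg[of x] by linarith
    have "x \<bullet> (M *\<^sub>v x) / (x \<bullet> x) \<le> t" unfolding t_def
    proof (rule cInf_greatest[OF ne])
      fix s assume "s \<in> T"
      thus "x \<bullet> (M *\<^sub>v x) / (x \<bullet> x) \<le> s" using x pos by (simp add: T_def divide_le_eq)
    qed
    thus ?thesis using pos by (simp add: divide_le_eq)
  qed
  define P where "P = t \<cdot>\<^sub>m 1\<^sub>m n - M"
  have P: "P \<in> carrier_mat n n" unfolding P_def using M(1) by (rule minus_carrier_mat)
  have PT: "transpose_mat P = P"
  proof -
    have "transpose_mat (t \<cdot>\<^sub>m 1\<^sub>m n) = t \<cdot>\<^sub>m 1\<^sub>m n" by (intro eq_matI) auto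
    thus ?thesis using M transpose_minus[of "t \<cdot>\<^sub>m 1\<^sub>m n" n n M] by (simp add: P_def)
  qed
  have Pv: "P *\<^sub>v x = t \<cdot>\<^sub>v x - M *\<^sub>v x" if "x \<in> carrier_vec n" for x
  proof -
    have "(t \<cdot>\<^sub>m 1\<^sub>m n) *\<^sub>v x = t \<cdot>\<^sub>v x" using that by (intro eq_vecI) auto
    thus ?thesis using M that by (simp add: P_def minus_mult_distrib_mat_vec[of _ n n])
  qed
  have Pq: "x \<bullet> (P *\<^sub>v x) = t * (x \<bullet> x) - x \<bullet> (M *\<^sub>v x)" if "x \<in> carrier_vec n" for x
    using M that by (simp add: Pv scalar_prod_minus_distrib[of _ n])
  have "det P = 0"
  proof (rule ccontr)
    assume "det P \<noteq> 0"
    moreover have "\<And>x. x \<in> carrier_vec n \<Longrightarrow> 0 \<le> x \<bullet> (P *\<^sub>v x)" using Pq top by simp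
    ultimately obtain c where c: "0 < c"
      "\<And>x. x \<in> carrier_vec n \<Longrightarrow> c * (x \<bullet> x) \<le> x \<bullet> (P *\<^sub>v x)"
      using psd_nonsingular_imp_coercive[OF P PT] by blast
    have "x \<bullet> (M *\<^sub>v x) \<le> (t - c) * (x \<bullet> x)" if "x \<in> carrier_vec n" for x
      using c(2)[OF that] Pq[OF that] by (simp add: left_diff_distrib)
    hence "t - c \<in> T" by (simp add: T_def)
    hence "t \<le> t - c" unfolding t_def by (rule cInf_lower[OF _ bdd])
    thus False using c(1) by simp
  qed
  then obtain v where v: "v \<in> carrier_vec n" "v \<noteq> 0\<^sub>v n" "P *\<^sub>v v = 0\<^sub>v n"
    using det_0_iff_vec_prod_zero_field[OF P] by blast
  have "M *\<^sub>v v = t \<cdot>\<^sub>v v"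
  proof (rule eq_vecI)
    fix i assume "i < dim_vec (t \<cdot>\<^sub>v v)"
    hence i: "i < n" using v by simp
    have "(t \<cdot>\<^sub>v v - M *\<^sub>v v) $ i = 0" using v i Pv by simp
    thus "(M *\<^sub>v v) $ i = (t \<cdot>\<^sub>v v) $ i" using i M v by simp
  qed (use M v in auto)
  hence "eigenvalue M t" unfolding eigenvalue_def eigenvector_def using v M by auto
  thus ?thesis using top that by blast
qed

lemma quadratic_form_le_Max_spectrum:
  fixes M :: "real mat"
  assumes "M \<in> carrier_mat n n" "transpose_mat M = M" "x \<in> carrier_vec n"
  shows "x \<bullet> (M *\<^sub>v x) \<le> Max (spectrum M) * (x \<bullet> x)"
proof (cases "n = 0")
  case True
  thus ?thesis using assms by (simp add: scalar_prod_def)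
next
  case False
  then obtain t where t: "eigenvalue M t" "x \<bullet> (M *\<^sub>v x) \<le> t * (x \<bullet> x)"
    using rayleigh_eigenvalue[OF assms(1,2)] assms(3) by blast
  have "t \<le> Max (spectrum M)"
    using t(1) card_finite_spectrum(1)[OF assms(1)] by (intro Max_ge) (auto simp: spectrum_def)
  hence "t * (x \<bullet> x) \<le> Max (spectrum M) * (x \<bullet> x)"
    by (intro mult_right_mono scalar_prod_self_nonneg)
  thus ?thesis using t(2) by linarith
qed

section \<open>Adjacency matrices and their inverses\<close>

lemma inv_mat_inverse:
  assumes A: "A \<in> carrier_mat n n" and inv: "invertible_mat A"
  shows "inv_mat A \<in> carrier_mat n n" "A * inv_mat A = 1\<^sub>m n" "inv_mat A * A = 1\<^sub>m n"
proof -
  obtain B where B: "A * B = 1\<^sub>m n" "B * A = 1\<^sub>m (dim_row B)"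
    using inv A unfolding invertible_mat_def inverts_mat_def by auto
  have "dim_col B = n" using B(1) by (metis index_mult_mat(3) index_one_mat(3))
  moreover have "dim_row B = n" using B(2) A by (metis carrier_matD(2) index_mult_mat(3) index_one_mat(3))
  ultimately have "B \<in> carrier_mat n n" by blast
  hence "A \<in> Units (ring_mat TYPE(real) n ())"
    using A B unfolding Units_def ring_mat_def by auto
  hence "mat_inverse A \<noteq> None" using mat_inverse(1)[OF A, of "()"] by blast
  hence "mat_inverse A = Some (inv_mat A)" by (simp add: inv_mat_def)
  from mat_inverse(2)[OF A this]
  show "inv_mat A \<in> carrier_mat n n" "A * inv_mat A = 1\<^sub>m n" "inv_mat A * A = 1\<^sub>m n" by auto
qed

lemma transpose_inv_mat:
  assumes A: "A \<in> carrier_mat n n" "transpose_mat A = A" and inv: "invertible_mat A"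
  shows "transpose_mat (inv_mat A) = inv_mat A"
proof -
  note I = inv_mat_inverse[OF A(1) inv]
  have "transpose_mat (inv_mat A) * A = 1\<^sub>m n"
    using transpose_mult[OF A(1) I(1)] A(2) I(2) by simp
  hence "transpose_mat (inv_mat A) * (A * inv_mat A) = 1\<^sub>m n * inv_mat A"
    using assoc_mult_mat[of "transpose_mat (inv_mat A)" n n A n "inv_mat A" n] A I by simp
  thus ?thesis using I by simp
qed

lemma finite_pos_spectrum:
  fixes M :: "real mat"
  assumes "M \<in> carrier_mat n n"
  shows "finite {x \<in> spectrum M. 0 < x}"
  using card_finite_spectrum(1)[OF assms] by simp

text \<open>
  The largest value of the quadratic form on the unit sphere is an eigenvalue, it is at least
  every diagonal entry, and it cannot vanish if the matrix is nonsingular.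
\<close>

lemma least_pos_eigenvalue_in_spectrum:
  fixes M :: "real mat"
  assumes M: "M \<in> carrier_mat n n" "transpose_mat M = M"
    and n: "0 < n" and d: "0 \<le> M $$ (0,0)" and nz: "\<not> eigenvalue M 0"
  shows "eigenvalue M (least_pos_eigenvalue M)" "0 < least_pos_eigenvalue M"
proof -
  obtain t where t: "eigenvalue M t" "\<And>x. x \<in> carrier_vec n \<Longrightarrow> x \<bullet> (M *\<^sub>v x) \<le> t * (x \<bullet> x)"
    using rayleigh_eigenvalue[OF M n] by blast
  have "M $$ (0,0) \<le> t"
    using t(2)[of "unit_vec n 0"] n M by simp
  moreover have "t \<noteq> 0" using t(1) nz by blast
  ultimately have "t \<in> {x \<in> spectrum M. 0 < x}" using t(1) d by (auto simp: spectrum_def)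
  hence "least_pos_eigenvalue M \<in> {x \<in> spectrum M. 0 < x}"
    unfolding least_pos_eigenvalue_def using finite_pos_spectrum[OF M(1)] by (intro Min_in) auto
  thus "eigenvalue M (least_pos_eigenvalue M)" "0 < least_pos_eigenvalue M"
    by (auto simp: spectrum_def)
qed

lemma eigenvalue_inv_mat:
  assumes A: "A \<in> carrier_mat n n" and inv: "invertible_mat A"
    and t: "eigenvalue (inv_mat A) t"
  shows "t \<noteq> 0" "eigenvalue A (1 / t)"
proof -
  note I = inv_mat_inverse[OF A inv]
  obtain v where v: "v \<in> carrier_vec n" "v \<noteq> 0\<^sub>v n" "inv_mat A *\<^sub>v v = t \<cdot>\<^sub>v v"
    using t I unfolding eigenvalue_def eigenvector_def by auto
  have "v = A *\<^sub>v (inv_mat A *\<^sub>v v)"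
    using assoc_mult_mat_vec[OF A I(1) v(1)] I(2) v(1) by simp
  also have "\<dots> = t \<cdot>\<^sub>v (A *\<^sub>v v)" using v A by (simp add: mult_mat_vec)
  finally have eq: "v = t \<cdot>\<^sub>v (A *\<^sub>v v)" .
  show t0: "t \<noteq> 0"
  proof
    assume "t = 0"
    have "v = 0 \<cdot>\<^sub>v (A *\<^sub>v v)" using eq unfolding \<open>t = 0\<close> .
    also have "\<dots> = 0\<^sub>v n" using A by (intro eq_vecI) auto
    finally show False using v by simp
  qed
  have "A *\<^sub>v v = (1 / t) \<cdot>\<^sub>v (t \<cdot>\<^sub>v (A *\<^sub>v v))" using t0 by (simp add: smult_smult_assoc)
  hence "A *\<^sub>v v = (1 / t) \<cdot>\<^sub>v v" unfolding eq[symmetric] .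
  thus "eigenvalue A (1 / t)" using v A unfolding eigenvalue_def eigenvector_def by auto
qed

lemma invertible_mat_not_eigenvalue_0:
  fixes A :: "real mat"
  assumes A: "A \<in> carrier_mat n n" and inv: "invertible_mat A"
  shows "\<not> eigenvalue A 0"
proof
  note I = inv_mat_inverse[OF A inv]
  assume "eigenvalue A 0"
  then obtain v where v: "v \<in> carrier_vec n" "v \<noteq> 0\<^sub>v n" "A *\<^sub>v v = 0 \<cdot>\<^sub>v v"
    using A unfolding eigenvalue_def eigenvector_def by auto
  have "v = inv_mat A *\<^sub>v (A *\<^sub>v v)"
    using assoc_mult_mat_vec[OF I(1) A v(1)] I(3) v(1) by simp
  also have "\<dots> = 0 \<cdot>\<^sub>v (inv_mat A *\<^sub>v v)" using v I by (simp add: mult_mat_vec)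
  also have "\<dots> = 0\<^sub>v n" using v I by (intro eq_vecI) auto
  finally show False using v by simp
qed

text \<open>
  The positive eigenvalues of the inverse are the reciprocals of the positive eigenvalues of the
  matrix, so the largest one belongs to the least positive one.
\<close>

lemma inverse_quadratic_form_le:
  assumes A: "graph_mat n A" "invertible_mat A" and n: "0 < n"
  shows "0 < least_pos_eigenvalue A"
    and "x \<in> carrier_vec n \<Longrightarrow> x \<bullet> (inv_mat A *\<^sub>v x) \<le> 1 / least_pos_eigenvalue A * (x \<bullet> x)"
proof -
  have Ac: "A \<in> carrier_mat n n" and At: "transpose_mat A = A" and "A $$ (0,0) \<in> \<nat>"
    using A(1) n unfolding graph_mat_def by auto
  hence d: "0 \<le> A $$ (0,0)" by (simp add: Nats_altdef2)
  let ?l = "least_pos_eigenvalue A"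
  show pos: "0 < ?l"
    using least_pos_eigenvalue_in_spectrum(2)[OF Ac At n d invertible_mat_not_eigenvalue_0[OF Ac A(2)]] .
  note I = inv_mat_inverse[OF Ac A(2)]
  obtain t where t: "eigenvalue (inv_mat A) t"
    "\<And>x. x \<in> carrier_vec n \<Longrightarrow> x \<bullet> (inv_mat A *\<^sub>v x) \<le> t * (x \<bullet> x)"
    using rayleigh_eigenvalue[OF I(1) transpose_inv_mat[OF Ac At A(2)] n] by blast
  have "t \<le> 1 / ?l"
  proof (cases "0 < t")
    case True
    hence "1 / t \<in> {x \<in> spectrum A. 0 < x}"
      using eigenvalue_inv_mat(2)[OF Ac A(2) t(1)] by (simp add: spectrum_def)
    hence "?l \<le> 1 / t"
      unfolding least_pos_eigenvalue_def using finite_pos_spectrum[OF Ac] by (intro Min_le)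
    thus ?thesis using True pos by (simp add: field_simps)
  next
    case False
    moreover have "0 < 1 / ?l" using pos by simp
    ultimately show ?thesis by linarith
  qed
  hence "t * (x \<bullet> x) \<le> 1 / ?l * (x \<bullet> x)"
    by (intro mult_right_mono scalar_prod_self_nonneg)
  thus "x \<bullet> (inv_mat A *\<^sub>v x) \<le> 1 / ?l * (x \<bullet> x)" if "x \<in> carrier_vec n"
    using t(2)[OF that] by linarith
qed

section \<open>Bridging\<close>

lemma bridge_mat_carrier:
  assumes "k \<le> min n m"
  shows "bridge_mat n m k \<in> carrier_mat n m"
  using assms four_block_carrier_mat[of "0\<^sub>m (n - k) k" "n - k" k "0\<^sub>m k (m - k)" k "m - k"]
  unfolding bridge_mat_def by auto

lemma bridge_mat_index:
  assumes "k \<le> min n m" "i < n" "j < m"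
  shows "bridge_mat n m k $$ (i,j) = (if n - k \<le> i \<and> j = i - (n - k) then 1 else 0)"
  using assms unfolding bridge_mat_def by auto

text \<open>
  The rows of the bridge matrix are unit vectors with index below \<open>k\<close> or zero, so conjugating
  with it only sees the leading \<open>k \<times> k\<close> block.
\<close>

lemma bridge_conj_eq_0:
  fixes M :: "real mat"
  assumes k: "k \<le> min n m" and M: "M \<in> carrier_mat m m"
    and z: "\<And>i j. i < k \<Longrightarrow> j < k \<Longrightarrow> M $$ (i,j) = 0"
  shows "bridge_mat n m k * M * transpose_mat (bridge_mat n m k) = 0\<^sub>m n n"
proof (rule eq_matI)
  let ?H = "bridge_mat n m k"
  note H = bridge_mat_carrier[OF k]
  fix i j assume "i < dim_row (0\<^sub>m n n)" "j < dim_col (0\<^sub>m n n)"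
  hence ij: "i < n" "j < n" by auto
  have "(?H * M * transpose_mat ?H) $$ (i,j)
      = (\<Sum>a = 0..<m. ?H $$ (i,a) * (\<Sum>b = 0..<m. M $$ (a,b) * ?H $$ (j,b)))"
    using H M ij by (simp add: scalar_prod_def)
  also have "\<dots> = 0"
  proof (intro sum.neutral ballI)
    fix a assume a: "a \<in> {0..<m}"
    show "?H $$ (i,a) * (\<Sum>b = 0..<m. M $$ (a,b) * ?H $$ (j,b)) = 0"
    proof (cases "a < k")
      case True
      have "(\<Sum>b = 0..<m. M $$ (a,b) * ?H $$ (j,b)) = 0"
      proof (intro sum.neutral ballI)
        fix b assume "b \<in> {0..<m}"
        thus "M $$ (a,b) * ?H $$ (j,b) = 0"
          using bridge_mat_index[OF k ij(2), of b] z[of a b] True ij k by (cases "b < k") auto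
      qed
      thus ?thesis by simp
    next
      case False
      thus ?thesis using bridge_mat_index[OF k ij(1), of a] a ij k by auto
    qed
  qed
  finally show "(?H * M * transpose_mat ?H) $$ (i,j) = 0\<^sub>m n n $$ (i,j)" using ij by simp
qed (use bridge_mat_carrier[OF k] in auto)

lemma symmetric_block_eigenvectorE:
  fixes A B H :: "real mat"
  assumes A: "A \<in> carrier_mat n n" and B: "B \<in> carrier_mat m m" and H: "H \<in> carrier_mat n m"
    and ev: "eigenvalue (four_block_mat A H (transpose_mat H) B) l"
  obtains x y where "x \<in> carrier_vec n" "y \<in> carrier_vec m" "x \<noteq> 0\<^sub>v n \<or> y \<noteq> 0\<^sub>v m"
    "A *\<^sub>v x + H *\<^sub>v y = l \<cdot>\<^sub>v x" "transpose_mat H *\<^sub>v x + B *\<^sub>v y = l \<cdot>\<^sub>v y"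
proof -
  let ?C = "four_block_mat A H (transpose_mat H) B"
  have HT: "transpose_mat H \<in> carrier_mat m n" using H by simp
  have C: "?C \<in> carrier_mat (n + m) (n + m)" using A B by simp
  obtain z where z: "z \<in> carrier_vec (n + m)" "z \<noteq> 0\<^sub>v (n + m)" "?C *\<^sub>v z = l \<cdot>\<^sub>v z"
    using ev C unfolding eigenvalue_def eigenvector_def by auto
  define x y where "x = vec_first z n" and "y = vec_last z m"
  have zxy: "z = x @\<^sub>v y" using vec_first_last_append[OF z(1)] by (simp add: x_def y_def)
  have x: "x \<in> carrier_vec n" and y: "y \<in> carrier_vec m" by (simp_all add: x_def y_def)
  have "(A *\<^sub>v x + H *\<^sub>v y) @\<^sub>v (transpose_mat H *\<^sub>v x + B *\<^sub>v y) = (l \<cdot>\<^sub>v x) @\<^sub>v (l \<cdot>\<^sub>v y)"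
    unfolding four_block_mat_mult_vec[OF A H HT B x y, symmetric] zxy[symmetric] z(3)
    unfolding zxy by (intro eq_vecI) auto
  hence "A *\<^sub>v x + H *\<^sub>v y = l \<cdot>\<^sub>v x \<and> transpose_mat H *\<^sub>v x + B *\<^sub>v y = l \<cdot>\<^sub>v y"
    using A B H x y by (subst (asm) append_vec_eq[of _ n]) auto
  moreover have "x \<noteq> 0\<^sub>v n \<or> y \<noteq> 0\<^sub>v m" using z(2) zxy by (auto simp: append_vec_def zero_vec_def)
  ultimately show ?thesis using that x y by blast
qed


text \<open>
  Here \<open>N\<close> is \<open>B\<^sup>-\<^sup>1\<close>. Applying \<open>H N\<close> to the second eigenvector equation kills the term with \<open>x\<close>
  and gives \<open>H y = l h\<close>, which decouples the first equation. For \<open>l \<noteq> 0\<close> the last identity is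
  the block formula for the quadratic form of \<open>C\<^sup>-\<^sup>1\<close> at the vector \<open>l (x, y)\<close>. The case \<open>l = 0\<close>
  of the first identity yields the nonsingularity of \<open>C\<close>.
\<close>

lemma bridged_eigenvector_identities:
  fixes A B H N :: "real mat"
  assumes A: "A \<in> carrier_mat n n"
    and N: "N \<in> carrier_mat m m" "transpose_mat N = N" "N * B = 1\<^sub>m m"
    and B: "B \<in> carrier_mat m m" and H: "H \<in> carrier_mat n m"
    and conj: "H * N * transpose_mat H = 0\<^sub>m n n"
    and x: "x \<in> carrier_vec n" and y: "y \<in> carrier_vec m"
    and e1: "A *\<^sub>v x + H *\<^sub>v y = l \<cdot>\<^sub>v x"
    and e2: "transpose_mat H *\<^sub>v x + B *\<^sub>v y = l \<cdot>\<^sub>v y"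
  defines "h \<equiv> H *\<^sub>v (N *\<^sub>v y)"
  shows "A *\<^sub>v x = l \<cdot>\<^sub>v (x - h)"
    and "l * (x \<bullet> x + y \<bullet> y) = x \<bullet> (A *\<^sub>v x) + l\<^sup>2 * (y \<bullet> (N *\<^sub>v y))"
proof -
  have HT: "transpose_mat H \<in> carrier_mat m n" using H by simp
  have Ny: "N *\<^sub>v y \<in> carrier_vec m" using N y by simp
  have HTx: "transpose_mat H *\<^sub>v x \<in> carrier_vec m" using HT x by simp
  have h: "h \<in> carrier_vec n" using H Ny by (simp add: h_def)
  have "N *\<^sub>v (transpose_mat H *\<^sub>v x + B *\<^sub>v y) = N *\<^sub>v (transpose_mat H *\<^sub>v x) + y"
    using N(1) HTx B y assoc_mult_mat_vec[OF N(1) B y] N(3)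
    by (simp add: mult_add_distrib_mat_vec[of _ m m])
  hence Ne: "N *\<^sub>v (transpose_mat H *\<^sub>v x) + y = l \<cdot>\<^sub>v (N *\<^sub>v y)"
    using e2 N(1) y by (simp add: mult_mat_vec[of _ m m])
  have NHTx: "N *\<^sub>v (transpose_mat H *\<^sub>v x) \<in> carrier_vec m" using N HTx by simp
  have "H *\<^sub>v (N *\<^sub>v (transpose_mat H *\<^sub>v x)) = (H * N * transpose_mat H) *\<^sub>v x"
    using assoc_mult_mat_vec[of "H * N" n m "transpose_mat H" n x]
      assoc_mult_mat_vec[of H n m N m "transpose_mat H *\<^sub>v x"] H N(1) HT x HTx by simp
  also have "\<dots> = 0\<^sub>v n"
    unfolding conj using x by (intro eq_vecI) (auto simp: scalar_prod_def)
  finally have z: "H *\<^sub>v (N *\<^sub>v (transpose_mat H *\<^sub>v x)) = 0\<^sub>v n" .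
  have "H *\<^sub>v (N *\<^sub>v (transpose_mat H *\<^sub>v x) + y) = H *\<^sub>v y"
    using mult_add_distrib_mat_vec[OF H NHTx y] z H y by simp
  hence Hy: "H *\<^sub>v y = l \<cdot>\<^sub>v h"
    unfolding Ne h_def using mult_mat_vec[OF H Ny, of l] by simp
  show Ax: "A *\<^sub>v x = l \<cdot>\<^sub>v (x - h)"
  proof (rule eq_vecI)
    fix i assume "i < dim_vec (l \<cdot>\<^sub>v (x - h))"
    hence i: "i < n" using h by simp
    have "(A *\<^sub>v x + l \<cdot>\<^sub>v h) $ i = (l \<cdot>\<^sub>v x) $ i" using e1 Hy by simp
    thus "(A *\<^sub>v x) $ i = (l \<cdot>\<^sub>v (x - h)) $ i"
      using i A x h by (simp del: index_mult_mat_vec add: right_diff_distrib)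
  qed (use A h in auto)
  have "l * (y \<bullet> (N *\<^sub>v y)) = y \<bullet> (l \<cdot>\<^sub>v (N *\<^sub>v y))" using y Ny by simp
  also have "\<dots> = y \<bullet> (N *\<^sub>v (transpose_mat H *\<^sub>v x)) + y \<bullet> y"
    unfolding Ne[symmetric] using y NHTx by (simp add: scalar_prod_add_distrib[of _ m])
  also have "y \<bullet> (N *\<^sub>v (transpose_mat H *\<^sub>v x)) = (transpose_mat H *\<^sub>v x) \<bullet> (N *\<^sub>v y)"
    using symmetric_scalar_prod[OF N(1,2) y HTx] .
  also have "\<dots> = x \<bullet> h" unfolding h_def using transpose_vec_mult_scalar[OF H Ny x] .
  finally have yN: "l * (y \<bullet> (N *\<^sub>v y)) = x \<bullet> h + y \<bullet> y" .
  have "x \<bullet> (A *\<^sub>v x) = l * (x \<bullet> x) - l * (x \<bullet> h)"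
    unfolding Ax using x h by (simp add: scalar_prod_minus_distrib[of _ n] right_diff_distrib)
  moreover have "l\<^sup>2 * (y \<bullet> (N *\<^sub>v y)) = l * (x \<bullet> h + y \<bullet> y)"
    unfolding yN[symmetric] by (simp add: power2_eq_square)
  ultimately show "l * (x \<bullet> x + y \<bullet> y) = x \<bullet> (A *\<^sub>v x) + l\<^sup>2 * (y \<bullet> (N *\<^sub>v y))"
    by (simp add: distrib_left)
qed

section \<open>The two-variable quadratic form\<close>

text \<open>
  If \<open>t\<close> exceeded the larger root of the characteristic polynomial
  \<open>(t - a) (t - b) - a t mu\<close> of the form in \<open>|x|\<close> and \<open>\<surd>Y\<close>, then \<open>t > a\<close> as well, and completing
  the square in \<open>x\<close> would leave a positive multiple of \<open>Y\<close> that is at most zero. So \<open>Y\<close> and \<open>h\<close> vanish, and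
  \<open>t > a\<close> forces \<open>x = 0\<close>.
\<close>

lemma le_larger_root_of_form_le:
  fixes x h :: "real vec" and a b mu t Y :: real
  assumes x: "x \<in> carrier_vec n" and h: "h \<in> carrier_vec n"
    and a: "0 < a" and mu: "0 \<le> mu" and Y: "0 \<le> Y" and hY: "h \<bullet> h \<le> mu * Y"
    and nz: "x \<bullet> x + Y \<noteq> 0"
    and le: "t * (x \<bullet> x + Y) \<le> a * ((x - h) \<bullet> (x - h)) + b * Y"
  shows "t \<le> (a * mu + a + b + sqrt ((a * mu + a + b)\<^sup>2 - 4 * a * b)) / 2"
proof (rule ccontr)
  define S where "S = a * mu + a + b"
  define D where "D = S\<^sup>2 - 4 * a * b"
  assume "\<not> ?thesis"
  hence t: "sqrt D < 2 * t - S" by (simp add: S_def D_def)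
  \<comment> \<open>The discriminant in the form that shows it nonnegative and the larger root at least \<open>a\<close>.\<close>
  have D: "D = (a - a * mu - b)\<^sup>2 + 4 * a\<^sup>2 * mu"
    by (simp add: D_def S_def power2_eq_square algebra_simps)
  hence D_ge: "(a - a * mu - b)\<^sup>2 \<le> D" using mu by simp
  hence D0: "0 \<le> D" by (meson order_trans zero_le_power2)
  have "a - a * mu - b \<le> sqrt D" using D_ge real_le_rsqrt by blast
  hence ta: "a < t" using t by (simp add: S_def)
  have "D < (2 * t - S)\<^sup>2"
    using t D0 by (metis real_sqrt_ge_zero real_sqrt_pow2 power_strict_mono pos2)
  hence disc: "0 < (t - a) * (t - b) - a * t * mu"
    by (simp add: D_def S_def power2_eq_square algebra_simps)
  define p where "p = t - a"
  have p: "0 < p" using ta by (simp add: p_def)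
  have comm: "h \<bullet> x = x \<bullet> h" using comm_scalar_prod[OF h x] .
  have sq: "(x - h) \<bullet> (x - h) = x \<bullet> x - 2 * (x \<bullet> h) + h \<bullet> h"
    using x h comm by (simp add: minus_scalar_prod_distrib[of _ n] scalar_prod_minus_distrib[of _ n])
  have "p * (x \<bullet> x) + 2 * a * (x \<bullet> h) - a * (h \<bullet> h) + (t - b) * Y \<le> 0"
    using le unfolding sq by (simp add: p_def algebra_simps)
  hence base: "p * (p * (x \<bullet> x) + 2 * a * (x \<bullet> h) - a * (h \<bullet> h) + (t - b) * Y) \<le> 0"
    using p by (simp add: mult_le_0_iff)
  \<comment> \<open>Multiplied by \<open>p\<close>, the form in \<open>x\<close> becomes \<open>|p x + a h|\<^sup>2 - a t |h|\<^sup>2\<close>, as \<open>a + p = t\<close>.\<close>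
  have "(p \<cdot>\<^sub>v x + a \<cdot>\<^sub>v h) \<bullet> (p \<cdot>\<^sub>v x + a \<cdot>\<^sub>v h)
      = p * p * (x \<bullet> x) + 2 * p * a * (x \<bullet> h) + a * a * (h \<bullet> h)"
    using x h comm
    by (simp add: add_scalar_prod_distrib[of _ n] scalar_prod_add_distrib[of _ n] algebra_simps)
  hence "0 \<le> p * p * (x \<bullet> x) + 2 * p * a * (x \<bullet> h) + a * a * (h \<bullet> h)"
    using scalar_prod_self_nonneg by metis
  hence "p * (t - b) * Y \<le> a * t * (h \<bullet> h)"
    using base by (simp add: p_def algebra_simps)
  also have "\<dots> \<le> a * t * (mu * Y)" using hY a ta by (intro mult_left_mono) auto
  finally have "((t - a) * (t - b) - a * t * mu) * Y \<le> 0" by (simp add: p_def algebra_simps)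
  hence Y0: "Y = 0" using disc Y by (simp add: mult_le_0_iff)
  hence "h \<bullet> h = 0" using hY scalar_prod_self_nonneg[of h] by simp
  hence "h = 0\<^sub>v n" using scalar_prod_self_eq_0_iff[OF h] by simp
  hence "t * (x \<bullet> x) \<le> a * (x \<bullet> x)" using le Y0 x by simp
  moreover have "0 < x \<bullet> x" using nz Y0 scalar_prod_self_nonneg[of x] by simp
  ultimately show False using ta by simp
qed

theorem theorem4:
  fixes n m k :: nat and A B H :: "real mat" and \<alpha> \<beta> \<mu> :: real
  assumes "graph_mat n A" and "graph_mat m B"
    and "invertible_mat A" and "invertible_mat B"
    and "1 \<le> k" and "k \<le> min n m"
    and "arbitrarily_bridgeable k B"
    and "H = bridge_mat n m k"
    and "\<mu> = Max (spectrum (inv_mat B * transpose_mat H * H * inv_mat B))"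
    and "\<alpha> = 1 / least_pos_eigenvalue A"
    and "\<beta> = 1 / least_pos_eigenvalue B"
  shows "least_pos_eigenvalue (bridged_graph k A B) \<ge>
           2 / (\<alpha> * \<mu> + \<alpha> + \<beta> + sqrt ((\<alpha> * \<mu> + \<alpha> + \<beta>)\<^sup>2 - 4 * \<alpha> * \<beta>))"
proof -
  have n: "0 < n" and m: "0 < m" using assms(5,6) by auto
  have A: "A \<in> carrier_mat n n" "transpose_mat A = A" and A00: "0 \<le> A $$ (0,0)"
    using assms(1) n unfolding graph_mat_def by (auto simp: Nats_altdef2)
  have B: "B \<in> carrier_mat m m" "transpose_mat B = B"
    using assms(2) unfolding graph_mat_def by auto
  have H: "H \<in> carrier_mat n m" unfolding assms(8) by (rule bridge_mat_carrier[OF assms(6)])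
  have HT: "transpose_mat H \<in> carrier_mat m n" using H by simp
  define N where "N = inv_mat B"
  note I = inv_mat_inverse[OF B(1) assms(4), folded N_def]
  have NT: "transpose_mat N = N" unfolding N_def by (rule transpose_inv_mat[OF B assms(4)])
  note J = inv_mat_inverse[OF A(1) assms(3)]
  have conj: "H * N * transpose_mat H = 0\<^sub>m n n"
    unfolding assms(8) using assms(7)
    by (intro bridge_conj_eq_0[OF assms(6) I(1)])
      (auto simp: arbitrarily_bridgeable_def N_def)
  have a: "0 < \<alpha>" "\<And>w. w \<in> carrier_vec n \<Longrightarrow> w \<bullet> (inv_mat A *\<^sub>v w) \<le> \<alpha> * (w \<bullet> w)"
    unfolding assms(10) using inverse_quadratic_form_le[OF assms(1,3) n] by auto
  have b: "\<And>w. w \<in> carrier_vec m \<Longrightarrow> w \<bullet> (N *\<^sub>v w) \<le> \<beta> * (w \<bullet> w)"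
    and b0: "0 < \<beta>"
    unfolding assms(11) N_def using inverse_quadratic_form_le[OF assms(2,4) m] by auto
  define C where "C = bridged_graph k A B"
  have C_block: "C = four_block_mat A H (transpose_mat H) B"
    unfolding C_def bridged_graph_def Let_def using A B assms(8) by simp
  have C: "C \<in> carrier_mat (n + m) (n + m)" unfolding C_block using A B by simp
  have CT: "transpose_mat C = C"
    unfolding C_block using transpose_four_block_mat[OF A(1) H HT B(1)] A(2) B(2) by simp
  have C00: "0 \<le> C $$ (0,0)" unfolding C_block using A(1) B(1) A00 n by simp
  \<comment> \<open>The least positive eigenvalue is a genuine minimum only if there is a positive eigenvalue,
    which nonsingularity guarantees.\<close>
  have C0: "\<not> eigenvalue C 0"
  proof
    assume "eigenvalue C 0"
    then obtain x y where x: "x \<in> carrier_vec n" and y: "y \<in> carrier_vec m"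
      and nz: "x \<noteq> 0\<^sub>v n \<or> y \<noteq> 0\<^sub>v m"
      and e1: "A *\<^sub>v x + H *\<^sub>v y = 0 \<cdot>\<^sub>v x" and e2: "transpose_mat H *\<^sub>v x + B *\<^sub>v y = 0 \<cdot>\<^sub>v y"
      unfolding C_block by (rule symmetric_block_eigenvectorE[OF A(1) B(1) H])
    have "A *\<^sub>v x = 0 \<cdot>\<^sub>v (x - H *\<^sub>v (N *\<^sub>v y))"
      by (rule bridged_eigenvector_identities(1)[OF A(1) I(1) NT I(3) B(1) H conj x y e1 e2])
    also have "\<dots> = 0 \<cdot>\<^sub>v x" using x H by (intro eq_vecI) auto
    finally have x0: "x = 0\<^sub>v n"
      using invertible_mat_not_eigenvalue_0[OF A(1) assms(3)] A(1) x
      unfolding eigenvalue_def eigenvector_def by auto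
    have "B *\<^sub>v y = transpose_mat H *\<^sub>v x + B *\<^sub>v y"
      unfolding x0 using HT B(1) y by (intro eq_vecI) (auto simp: scalar_prod_def)
    hence "y = 0\<^sub>v m"
      using e2 invertible_mat_not_eigenvalue_0[OF B(1) assms(4)] B(1) y
      unfolding eigenvalue_def eigenvector_def by auto
    thus False using x0 nz by simp
  qed
  define l where "l = least_pos_eigenvalue C"
  have l: "eigenvalue C l" "0 < l"
    using least_pos_eigenvalue_in_spectrum[OF C CT _ C00 C0] n unfolding l_def by auto
  obtain x y where x: "x \<in> carrier_vec n" and y: "y \<in> carrier_vec m"
    and nz: "x \<noteq> 0\<^sub>v n \<or> y \<noteq> 0\<^sub>v m"
    and e1: "A *\<^sub>v x + H *\<^sub>v y = l \<cdot>\<^sub>v x" and e2: "transpose_mat H *\<^sub>v x + B *\<^sub>v y = l \<cdot>\<^sub>v y"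
    using l(1) unfolding C_block by (rule symmetric_block_eigenvectorE[OF A(1) B(1) H])
  define h where "h = H *\<^sub>v (N *\<^sub>v y)"
  note ids = bridged_eigenvector_identities[OF A(1) I(1) NT I(3) B(1) H conj x y e1 e2,
      folded h_def]
  have h: "h \<in> carrier_vec n" unfolding h_def using H I(1) y by simp
  define M where "M = N * transpose_mat H * H * N"
  have M: "M \<in> carrier_mat m m" 
    unfolding M_def
    by (rule mult_carrier_mat[OF mult_carrier_mat[OF mult_carrier_mat[OF I(1) HT] H] I(1)])
  have M_eq: "M = transpose_mat (H * N) * (H * N)"
    unfolding M_def using I(1) H HT NT
    by (simp add: transpose_mult[of H n m N m] assoc_mult_mat[of _ m m _ n _ m]
        assoc_mult_mat[of _ m n _ m _ m] assoc_mult_mat[of _ m m _ m _ m])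
  have MT: "transpose_mat M = M"
    unfolding M_eq using H I(1) transpose_mult[of "transpose_mat (H * N)" m n "H * N" m] by simp
  have Mq: "w \<bullet> (M *\<^sub>v w) = (H *\<^sub>v (N *\<^sub>v w)) \<bullet> (H *\<^sub>v (N *\<^sub>v w))"
    if w: "w \<in> carrier_vec m" for w
  proof -
    have HN: "H * N \<in> carrier_mat n m" using H I(1) by simp
    have HNw: "(H * N) *\<^sub>v w \<in> carrier_vec n" using HN w by simp
    have "w \<bullet> (M *\<^sub>v w) = w \<bullet> (transpose_mat (H * N) *\<^sub>v ((H * N) *\<^sub>v w))"
      unfolding M_eq using HN w assoc_mult_mat_vec[of "transpose_mat (H * N)" m n "H * N" m w]
      by simp
    also have "\<dots> = ((H * N) *\<^sub>v w) \<bullet> ((H * N) *\<^sub>v w)"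
      using transpose_vec_mult_scalar[OF HN w HNw] HN HNw w
        comm_scalar_prod[of w m "transpose_mat (H * N) *\<^sub>v ((H * N) *\<^sub>v w)"] by simp
    finally show ?thesis using assoc_mult_mat_vec[OF H I(1) w] by simp
  qed
  have mu_bound: "w \<bullet> (M *\<^sub>v w) \<le> \<mu> * (w \<bullet> w)" if "w \<in> carrier_vec m" for w
    using quadratic_form_le_Max_spectrum[OF M MT that]
    unfolding assms(9) M_def N_def .
  \<comment> \<open>\<open>M\<close> is a Gram matrix, so its form is nonnegative at any unit vector.\<close>
  have mu0: "0 \<le> \<mu>"
  proof -
    have "0 \<le> unit_vec m 0 \<bullet> (M *\<^sub>v unit_vec m 0)"
      unfolding Mq[OF unit_vec_carrier] by (rule scalar_prod_self_nonneg)
    thus ?thesis using mu_bound[of "unit_vec m 0"] m by simp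
  qed
  have hY: "h \<bullet> h \<le> \<mu> * (y \<bullet> y)" using Mq[OF y] mu_bound[OF y] by (simp add: h_def)
  have "x \<bullet> (A *\<^sub>v x) \<le> \<alpha> * (l\<^sup>2 * ((x - h) \<bullet> (x - h)))"
  proof -
    have Ax: "A *\<^sub>v x \<in> carrier_vec n" using A x by simp
    have "inv_mat A *\<^sub>v (A *\<^sub>v x) = x"
      using assoc_mult_mat_vec[OF J(1) A(1) x] J(3) x by simp
    hence "x \<bullet> (A *\<^sub>v x) = (A *\<^sub>v x) \<bullet> (inv_mat A *\<^sub>v (A *\<^sub>v x))"
      using comm_scalar_prod[OF x Ax] by simp
    also have "\<dots> \<le> \<alpha> * ((A *\<^sub>v x) \<bullet> (A *\<^sub>v x))" by (rule a(2)[OF Ax])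
    also have "(A *\<^sub>v x) \<bullet> (A *\<^sub>v x) = l\<^sup>2 * ((x - h) \<bullet> (x - h))"
      unfolding ids(1) using x h by (simp add: power2_eq_square)
    finally show ?thesis .
  qed
  moreover have "l\<^sup>2 * (y \<bullet> (N *\<^sub>v y)) \<le> l\<^sup>2 * (\<beta> * (y \<bullet> y))"
    using b[OF y] by (intro mult_left_mono) auto
  ultimately have "l * (x \<bullet> x + y \<bullet> y)
      \<le> l\<^sup>2 * (\<alpha> * ((x - h) \<bullet> (x - h)) + \<beta> * (y \<bullet> y))"
    using ids(2) by (simp add: algebra_simps)
  hence form: "1 / l * (x \<bullet> x + y \<bullet> y) \<le> \<alpha> * ((x - h) \<bullet> (x - h)) + \<beta> * (y \<bullet> y)"
    using l(2) by (simp add: power2_eq_square divide_le_eq mult.assoc mult.commute)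
  have "x \<bullet> x + y \<bullet> y \<noteq> 0"
    using nz scalar_prod_self_eq_0_iff[OF x] scalar_prod_self_eq_0_iff[OF y]
      scalar_prod_self_nonneg[of x] scalar_prod_self_nonneg[of y]
    by linarith
  from le_larger_root_of_form_le[OF x h a(1) mu0 scalar_prod_self_nonneg hY this form]
  have "1 / l \<le> (\<alpha> * \<mu> + \<alpha> + \<beta> + sqrt ((\<alpha> * \<mu> + \<alpha> + \<beta>)\<^sup>2 - 4 * \<alpha> * \<beta>)) / 2" .
  moreover have "2 / r \<le> l" if "1 / l \<le> r / 2" for r
  proof -
    have "0 < 1 / l" using l(2) by simp
    hence "0 < r" using that by linarith
    thus ?thesis using that l(2) by (simp add: field_simps)
  qed
  ultimately show ?thesis unfolding l_def C_def by blast
qed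

end
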